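(* Let $n$ be an odd positive integer such that $n=p_1^{r_1}p_2^{r_2}\cdots p_k^{r_k}$, where $p_1<p_2<\cdots<p_k$ are primes and $r_i\in\mathbb{N}$. Then the Laplacian eigenvalues of $\Gamma(\mathbb{Z}_n)$ are given by $$\left\lbrace 0,\ 2\left(p\left(A_{[k],k}\right)-k\right),\ p\left(A_{[k],k}\right)-p\left(A_{[k],l}^{(j)}\right),\ p\left(A_{[k],k}\right)+p\left(A_{[k],l}^{(j)}\right)-2k,\ p\left(A_{[k],k}\right)-2k,\ p\left(A_{[k],k}\right)\right\rbrace,$$ where $l=1,2,\ldots,k-1$ and $j=1,2,\ldots,\binom{k}{l}$.
   Context: For a finite group $G$, the prime order element graph $\Gamma(G)$ is the graph with vertex set $G$ in which two distinct vertices $x,y\in G$ are adjacent if and only if the order of the product $xy$ (the sum $x+y$ if $G$ is written additively) is prime. $\mathbb{Z}_n$ denotes the cyclic group of order $n$. The Laplacian eigenvalues of a graph are the eigenvalues of its Laplacian matrix, that is, the diagonal matrix of vertex degrees minus the adjacency matrix. Notation: $[k]=\{1,2,\ldots,k\}$; for $1\le l\le k$, the $l$-element subsets of $[k]$ are denoted $A_{[k],l}^{(j)}$, $j=1,2,\ldots,\binom{k}{l}$, and $A_{[k],k}=[k]$; for $T\subseteq[k]$, $p(T):=\sum_{i\in T}p_i$.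
   Formalization: The list is proved as stated when some r_i ≥ 2; when all r_i = 1 the entry 2(p(A_{[k],k}) − k) is left out, since it is then not an eigenvalue (for n = 3 the Laplacian eigenvalues are 0, 1, 3, but the list contains 4). *)

theory Defs
  imports
    "HOL-Algebra.Elementary_Groups"
    "HOL-Algebra.Multiplicative_Group"
    "HOL-Computational_Algebra.Primes"
    "Graph_Theory.Pair_Digraph"
    "Jordan_Normal_Form.Spectral_Radius"
begin

text \<open>A simple graph is represented as a symmetric, loop-free pair digraph: every edge
  \<open>{x, y}\<close> appears as the two arcs \<open>(x, y)\<close> and \<open>(y, x)\<close>, so that the out-degree of a
  vertex is its degree.\<close>

definition prime_order_graph :: "('a, 'm) monoid_scheme \<Rightarrow> 'a pair_pre_digraph" where
  "prime_order_graph G =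
     \<lparr> pverts = carrier G,
       parcs = {(x, y). x \<in> carrier G \<and> y \<in> carrier G \<and> x \<noteq> y \<and>
                        Factorial_Ring.prime (group.ord G (x \<otimes>\<^bsub>G\<^esub> y))} \<rparr>"

text \<open>Matrices are indexed by natural numbers, so the matrices of a graph are taken with
  respect to a list \<open>vs\<close> enumerating its vertices without repetition.\<close>

definition adjacency_matrix :: "'v pair_pre_digraph \<Rightarrow> 'v list \<Rightarrow> 'a :: comm_ring_1 mat" where
  "adjacency_matrix \<Gamma> vs =
     mat (length vs) (length vs) (\<lambda>(i, j). if (vs ! i, vs ! j) \<in> parcs \<Gamma> then 1 else 0)"

definition degree_matrix :: "'v pair_pre_digraph \<Rightarrow> 'v list \<Rightarrow> 'a :: comm_ring_1 mat" where
  "degree_matrix \<Gamma> vs =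
     mat (length vs) (length vs)
       (\<lambda>(i, j). if i = j then of_nat (out_degree (with_proj \<Gamma>) (vs ! i)) else 0)"

definition laplacian_matrix :: "'v pair_pre_digraph \<Rightarrow> 'v list \<Rightarrow> 'a :: comm_ring_1 mat" where
  "laplacian_matrix \<Gamma> vs = degree_matrix \<Gamma> vs - adjacency_matrix \<Gamma> vs"

text \<open>The complex field is used, so that all eigenvalues are accounted for.\<close>

definition laplacian_eigenvalues :: "'v pair_pre_digraph \<Rightarrow> 'v list \<Rightarrow> complex set" where
  "laplacian_eigenvalues \<Gamma> vs = spectrum (laplacian_matrix \<Gamma> vs)"

text \<open>The arc relation of \<open>prime_order_graph\<close> is symmetric, since \<open>y x = x\<inverse> (x y) x\<close>.\<close>

lemma (in group) ord_mult_commute: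
  assumes x: "x \<in> carrier G" and y: "y \<in> carrier G"
  shows "ord (x \<otimes> y) = ord (y \<otimes> x)"
proof -
  have shift: "x \<otimes> (y \<otimes> x) [^] m = (x \<otimes> y) [^] m \<otimes> x" for m :: nat
  proof (induction m)
    case (Suc m)
    have "x \<otimes> (y \<otimes> x) [^] Suc m = (x \<otimes> (y \<otimes> x) [^] m) \<otimes> (y \<otimes> x)"
      using x y by (simp add: m_assoc)
    also have "\<dots> = (x \<otimes> y) [^] Suc m \<otimes> x"
      using x y by (simp add: Suc.IH m_assoc)
    finally show ?case .
  qed (use x in simp)
  have "(x \<otimes> y) [^] m = \<one> \<longleftrightarrow> (y \<otimes> x) [^] m = \<one>" for m :: nat
  proof -
    have "(x \<otimes> y) [^] m = \<one> \<longleftrightarrow> (x \<otimes> y) [^] m \<otimes> x = x"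
      using x y by simp
    also have "\<dots> \<longleftrightarrow> x \<otimes> (y \<otimes> x) [^] m = x"
      by (simp add: shift)
    also have "\<dots> \<longleftrightarrow> (y \<otimes> x) [^] m = \<one>"
      using x y by simp
    finally show ?thesis .
  qed
  then show ?thesis
    by (simp add: ord_def)
qed

lemma (in group) pair_graph_prime_order_graph:
  assumes "finite (carrier G)"
  shows "pair_graph (prime_order_graph G)"
proof
  let ?E = "parcs (prime_order_graph G)"
  show "finite (pverts (prime_order_graph G))"
    using assms by (simp add: prime_order_graph_def)
  show "finite ?E"
    by (rule finite_subset[of _ "carrier G \<times> carrier G"])
      (use assms in \<open>auto simp: prime_order_graph_def\<close>)
  have "(y, x) \<in> ?E" if "(x, y) \<in> ?E" for x y
    using that ord_mult_commute[of x y] by (auto simp: prime_order_graph_def)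
  then show "symmetric (with_proj (prime_order_graph G))"
    by (auto simp: symmetric_def arcs_ends_conv intro!: symI)
qed (auto simp: prime_order_graph_def)

end

theory Submission
  imports Defs
begin

text \<open>Let \<open>S\<close> be the set of elements of prime order in \<open>\<int>\<^sub>n\<close> and let \<open>A\<close> be the operator
  \<open>(A f) x = (\<Sum>y | x + y \<in> S. f y)\<close>.  Loops cancel in the Laplacian, so it equals
  \<open>|S| - A\<close>.  A character \<open>\<chi>\<^sub>a\<close> satisfies \<open>A \<chi>\<^sub>a = c\<^sub>a \<chi>\<^sub>-\<^sub>a\<close> with \<open>c\<^sub>a = (\<Sum>s\<in>S. \<chi>\<^sub>a s) = c\<^sub>-\<^sub>a\<close>,
  so \<open>\<chi>\<^sub>a \<plusminus> \<chi>\<^sub>-\<^sub>a\<close> are eigenvectors for \<open>\<plusminus>c\<^sub>a\<close>; they do not vanish for \<open>a \<noteq> 0\<close>, as \<open>n\<close> is odd, and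
  by Fourier inversion there are no further eigenvalues.
  Splitting \<open>S\<close> by order gives \<open>c\<^sub>a = p(T) - k\<close> with \<open>T = {i. p\<^sub>i dvd a}\<close>, and \<open>T\<close> ranges over all
  subsets of \<open>[k]\<close>, where \<open>T = [k]\<close> requires \<open>a \<noteq> 0\<close> to be divisible by every \<open>p\<^sub>i\<close>, that is,
  some \<open>r\<^sub>i \<ge> 2\<close>.\<close>

section \<open>The Laplacian as an operator on functions on the group\<close>

text \<open>As \<open>vs\<close> is distinct, indexing is a bijection onto the vertices. Vectors
  thus become functions on vertices, and the enumeration disappears from the eigenvalue
  equation.\<close>

lemma mem_spectrum_mat_nth_iff:
  fixes K :: "'v \<Rightarrow> 'v \<Rightarrow> 'a :: field"
  assumes "distinct vs"
  shows "ev \<in> spectrum (mat (length vs) (length vs) (\<lambda>(i, j). K (vs ! i) (vs ! j))) \<longleftrightarrow>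
    (\<exists>f. (\<exists>x\<in>set vs. f x \<noteq> 0) \<and> (\<forall>x\<in>set vs. (\<Sum>y\<in>set vs. K x y * f y) = ev * f x))"
    (is "ev \<in> spectrum ?A \<longleftrightarrow> ?R")
proof -
  have reindex: "(\<Sum>j\<in>{0..<length vs}. g (vs ! j)) = (\<Sum>y\<in>set vs. g y)" for g :: "'v \<Rightarrow> 'a"
    using bij_betw_nth[OF assms refl refl] sum.reindex_bij_betw[of "(!) vs" _ "set vs" g]
    by (simp add: atLeast0LessThan)
  have eigen: "eigenvector ?A (vec (length vs) (\<lambda>i. f (vs ! i))) ev \<longleftrightarrow>
      (\<exists>x\<in>set vs. f x \<noteq> 0) \<and> (\<forall>x\<in>set vs. (\<Sum>y\<in>set vs. K x y * f y) = ev * f x)" for f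
  proof -
    have "(?A *\<^sub>v vec (length vs) (\<lambda>i. f (vs ! i))) $ i = (\<Sum>y\<in>set vs. K (vs ! i) y * f y)"
      if "i < length vs" for i
      using that by (simp add: scalar_prod_def flip: reindex)
    then have "?A *\<^sub>v vec (length vs) (\<lambda>i. f (vs ! i)) =
          vec (length vs) (\<lambda>i. \<Sum>y\<in>set vs. K (vs ! i) y * f y)"
      by (intro eq_vecI) simp_all
    then show ?thesis
      by (fastforce simp: eigenvector_def vec_eq_iff all_set_conv_all_nth in_set_conv_nth)
  qed
  have "eigenvalue ?A ev \<longleftrightarrow> (\<exists>f. eigenvector ?A (vec (length vs) (\<lambda>i. f (vs ! i))) ev)"
  proof
    assume "eigenvalue ?A ev"
    then obtain v where v: "eigenvector ?A v ev"
      unfolding eigenvalue_def ..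
    \<comment> \<open>Transports \<open>v\<close> back along the enumeration; only the values of
      \<open>f\<close> on \<open>set vs\<close> matter.\<close>
    define f where "f x = v $ (inv_into {..<length vs} ((!) vs) x)" for x
    have "f (vs ! i) = v $ i" if "i < length vs" for i
      using that inj_on_nth[OF assms, of "{..<length vs}"] by (simp add: f_def inv_into_f_f)
    moreover have "dim_vec v = length vs"
      using v by (simp add: eigenvector_def carrier_vecD)
    ultimately have "vec (length vs) (\<lambda>i. f (vs ! i)) = v"
      by (intro eq_vecI) simp_all
    then have "eigenvector ?A (vec (length vs) (\<lambda>i. f (vs ! i))) ev"
      by (simp only: v)
    then show "\<exists>f. eigenvector ?A (vec (length vs) (\<lambda>i. f (vs ! i))) ev"
      by (rule exI[where x = f])
  qed (unfold eigenvalue_def, blast)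
  then show ?thesis
    by (simp add: spectrum_def eigen)
qed

text \<open>Row \<open>x\<close> of degree minus adjacency sums \<open>f x - f y\<close> over the
  neighbours \<open>y\<close>. The sum need not exclude \<open>y = x\<close>, because that term is
  zero.\<close>

lemma (in group) mem_laplacian_eigenvalues_prime_order_graph_iff:
  assumes "distinct vs" "set vs = carrier G"
  shows "ev \<in> laplacian_eigenvalues (prime_order_graph G) vs \<longleftrightarrow>
    (\<exists>f. (\<exists>x\<in>carrier G. f x \<noteq> 0) \<and>
      (\<forall>x\<in>carrier G.
        (\<Sum>y | y \<in> carrier G \<and> Factorial_Ring.prime (ord (x \<otimes> y)). f x - f y) = ev * f x))"
proof -
  let ?E = "parcs (prime_order_graph G)"
  have fin: "finite (carrier G)"
    using assms(2) by (metis List.finite_set)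
  define K :: "'a \<Rightarrow> 'a \<Rightarrow> complex" where
    "K x y = (if x = y then of_nat (out_degree (with_proj (prime_order_graph G)) x) else 0) -
             (if (x, y) \<in> ?E then 1 else 0)" for x y
  have "laplacian_matrix (prime_order_graph G) vs =
      mat (length vs) (length vs) (\<lambda>(i, j). K (vs ! i) (vs ! j))"
    by (rule eq_matI) (use assms in \<open>auto simp: laplacian_matrix_def degree_matrix_def
        adjacency_matrix_def K_def nth_eq_iff_index_eq\<close>)
  moreover have "(\<Sum>y\<in>set vs. K x y * f y) =
      (\<Sum>y | y \<in> carrier G \<and> Factorial_Ring.prime (ord (x \<otimes> y)). f x - f y)"
    if x: "x \<in> carrier G" for x f
  proof -
    let ?N = "{y \<in> carrier G. (x, y) \<in> ?E}"
    have "out_arcs (with_proj (prime_order_graph G)) x = Pair x ` ?N"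
      using x by (auto simp: out_arcs_def prime_order_graph_def)
    then have deg: "out_degree (with_proj (prime_order_graph G)) x = card ?N"
      by (simp add: out_degree_def card_image inj_on_def)
    have "(\<Sum>y\<in>set vs. K x y * f y) =
        (\<Sum>y\<in>carrier G. if x = y then of_nat (card ?N) * f y else 0) -
        (\<Sum>y\<in>carrier G. if (x, y) \<in> ?E then f y else 0)"
      unfolding assms(2) K_def deg sum_subtractf[symmetric]
      by (intro sum.cong) (auto simp: left_diff_distrib)
    also have "\<dots> = (\<Sum>y\<in>?N. f x - f y)"
      using fin x by (simp add: sum_subtractf sum.inter_filter)
    also have "\<dots> = (\<Sum>y | y \<in> carrier G \<and> Factorial_Ring.prime (ord (x \<otimes> y)). f x - f y)"
      using fin x by (intro sum.mono_neutral_left) (auto simp: prime_order_graph_def)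
    finally show ?thesis .
  qed
  ultimately show ?thesis
    using assms by (simp add: laplacian_eigenvalues_def mem_spectrum_mat_nth_iff)
qed

section \<open>Characters of the cyclic group\<close>

lemma bij_betw_add_mod:
  fixes y :: int
  assumes "n > 0"
  shows "bij_betw (\<lambda>x. (x + y) mod n) {0..<n} {0..<n}"
proof (rule bij_betw_byWitness[where f' = "\<lambda>x. (x - y) mod n"])
  show "\<forall>x\<in>{0..<n}. ((x + y) mod n - y) mod n = x"
    by (simp add: mod_diff_left_eq)
  show "\<forall>x\<in>{0..<n}. ((x - y) mod n + y) mod n = x"
    by (simp add: mod_add_left_eq)
qed (use assms in auto)

text \<open>The character of index \<open>a\<close> on the integers mod \<open>n\<close>, extended
  to all integers so that sums and negatives can be formed without reduction.\<close>

definition zchar :: "nat \<Rightarrow> int \<Rightarrow> int \<Rightarrow> complex" where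
  "zchar n a x = cis (2 * pi * (of_int (a * x) / of_nat n))"

lemma zchar_0 [simp]: "zchar n 0 x = 1" "zchar n a 0 = 1"
  by (simp_all add: zchar_def)

lemma zchar_commute: "zchar n a x = zchar n x a"
  by (simp add: zchar_def mult.commute)

lemma zchar_uminus_left: "zchar n (- a) x = zchar n a (- x)"
  by (simp add: zchar_def)

lemma zchar_add: "zchar n a (x + y) = zchar n a x * zchar n a y"
  by (simp add: zchar_def cis_mult ring_distribs add_divide_distrib)

lemma zchar_eq_1_iff:
  assumes "n > 0"
  shows "zchar n a x = 1 \<longleftrightarrow> int n dvd a * x"
proof
  assume "zchar n a x = 1"
  \<comment> \<open>The real part is enough: where the cosine is 1, the angle is a multiple of
    \<open>2 * pi\<close>.\<close>
  then have "cos (2 * pi * (of_int (a * x) / of_nat n)) = 1"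
    by (simp add: zchar_def complex_eq_iff)
  then obtain m :: int where "2 * pi * (of_int (a * x) / of_nat n) = m * 2 * pi"
    by (auto simp: cos_one_2pi_int)
  then have "of_int (a * x) = (of_int (int n * m) :: real)"
    using assms by (simp add: field_simps)
  then have "a * x = int n * m"
    by (simp only: of_int_eq_iff)
  then show "int n dvd a * x"
    by simp
next
  assume "int n dvd a * x"
  then obtain m where "a * x = int n * m" ..
  then have "of_int (a * x) / of_nat n = (of_int m :: real)"
    using assms by (simp only: of_int_mult) simp
  then show "zchar n a x = 1"
    by (simp only: zchar_def cis_multiple_2pi Ints_of_int)
qed

lemma zchar_cong:
  assumes "n > 0" "x mod int n = y mod int n"
  shows "zchar n a x = zchar n a y"
proof -
  have "int n dvd a * (x - y)"
    using assms(2) by (simp add: mod_eq_dvd_iff)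
  then have "zchar n a (x - y) = 1"
    using assms(1) by (simp add: zchar_eq_1_iff)
  then show ?thesis
    using zchar_add[of n a "x - y" y] by simp
qed

lemma zchar_mod: "n > 0 \<Longrightarrow> zchar n a (x mod int n) = zchar n a x"
  by (rule zchar_cong) simp_all

text \<open>Orthogonality: shifting the variable by 1 permutes the residues and multiplies the sum
  by \<open>zchar n a 1\<close>, so the sum vanishes unless this factor is 1.\<close>

lemma sum_zchar:
  assumes "n > 0"
  shows "(\<Sum>x\<in>{0..<int n}. zchar n a x) = (if int n dvd a then of_nat n else 0)"
proof (cases "int n dvd a")
  case True
  then have "zchar n a x = 1" for x
    using assms by (simp add: zchar_eq_1_iff)
  then show ?thesis
    using True by simp
next
  case False
  have "(\<Sum>x\<in>{0..<int n}. zchar n a x) = (\<Sum>x\<in>{0..<int n}. zchar n a ((x + 1) mod int n))"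
    using assms by (intro sum.reindex_bij_betw[symmetric] bij_betw_add_mod) simp
  also have "\<dots> = (\<Sum>x\<in>{0..<int n}. zchar n a x) * zchar n a 1"
    using assms by (simp only: zchar_mod zchar_add sum_distrib_right)
  finally have "(\<Sum>x\<in>{0..<int n}. zchar n a x) = 0 \<or> zchar n a 1 = 1"
    by simp
  then show ?thesis
    using False assms by (simp add: zchar_eq_1_iff)
qed

text \<open>Fourier inversion: after swapping the sums, orthogonality leaves only
  \<open>y = x\<close>. It applies to the sum over the index \<open>a\<close> because
  \<open>zchar\<close> is symmetric in index and argument.\<close>

lemma zchar_inversion:
  assumes "n > 0" "x \<in> {0..<int n}"
  shows "(\<Sum>a\<in>{0..<int n}. zchar n a (- x) * (\<Sum>y\<in>{0..<int n}. zchar n a y * f y)) = of_nat n * f x"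
proof -
  have eq: "int n dvd y - x \<longleftrightarrow> y = x" if "y \<in> {0..<int n}" for y
    using that assms by (auto simp: mod_eq_dvd_iff[symmetric])
  have diff: "zchar n a (y - x) = zchar n a (- x) * zchar n a y" for a y
    using zchar_add[of n a y "- x"] by simp
  have "(\<Sum>a\<in>{0..<int n}. zchar n a (- x) * (\<Sum>y\<in>{0..<int n}. zchar n a y * f y)) =
        (\<Sum>y\<in>{0..<int n}. (\<Sum>a\<in>{0..<int n}. zchar n a (y - x)) * f y)"
    unfolding sum_distrib_left sum_distrib_right diff
    by (subst sum.swap) (simp only: mult_ac)
  also have "\<dots> = (\<Sum>y\<in>{0..<int n}. if y = x then of_nat n * f y else 0)"
    using assms(1) by (intro sum.cong) (auto simp: zchar_commute[of n _ "_ - _"] sum_zchar eq)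
  also have "\<dots> = of_nat n * f x"
    using assms by simp
  finally show ?thesis .
qed

section \<open>Elements of prime order and their character sums\<close>

definition prime_ord_elems :: "nat \<Rightarrow> int set" where
  "prime_ord_elems n =
     {x \<in> {0..<int n}. Factorial_Ring.prime (group.ord (integer_mod_group n) x)}"

text \<open>An order dividing the prime \<open>q\<close> is \<open>q\<close> or 1, and only 0 has
  order 1.\<close>

lemma ord_integer_mod_group_eq_prime_iff:
  assumes "n > 0" "x \<in> {0..<int n}" "Factorial_Ring.prime q"
  shows "group.ord (integer_mod_group n) x = q \<longleftrightarrow> x \<noteq> 0 \<and> int n dvd int q * x"
proof -
  interpret group "integer_mod_group n" by simp
  have x: "x \<in> carrier (integer_mod_group n)"
    using assms by (simp add: carrier_integer_mod_group)
  have "ord x dvd q \<longleftrightarrow> int n dvd int q * x"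
    using pow_eq_id[OF x, of q] by (auto simp: dvd_eq_mod_eq_0)
  moreover have "ord x = 1 \<longleftrightarrow> x = 0"
    using ord_eq_1[OF x] by simp
  ultimately show ?thesis
    using assms(3) by (metis One_nat_def dvd_refl not_prime_1 prime_nat_iff)
qed

text \<open>The solutions form the subgroup of order \<open>q\<close>, generated by
  \<open>n div q\<close>. The parametrisation turns sums over it into sums over residues mod
  \<open>q\<close>.\<close>

lemma multiples_eq_image:
  assumes "n > 0" "q dvd n"
  shows "{x \<in> {0..<int n}. int n dvd int q * x} = (\<lambda>j. int (n div q) * j) ` {0..<int q}"
proof -
  obtain m where n: "n = q * m" and "q > 0" "m > 0"
    using assms by (auto simp: dvd_def)
  have "x \<in> {0..<int n} \<and> int n dvd int q * x \<longleftrightarrow> x \<in> (\<lambda>j. int m * j) ` {0..<int q}" for x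
  proof
    assume x: "x \<in> {0..<int n} \<and> int n dvd int q * x"
    then have "int m dvd x"
      using \<open>q > 0\<close> by (simp add: n)
    then obtain j where "x = int m * j" ..
    then show "x \<in> (\<lambda>j. int m * j) ` {0..<int q}"
      using x \<open>m > 0\<close> by (simp add: n mult.commute[of "int q"] zero_le_mult_iff)
  next
    assume "x \<in> (\<lambda>j. int m * j) ` {0..<int q}"
    then show "x \<in> {0..<int n} \<and> int n dvd int q * x"
      using \<open>m > 0\<close> by (auto simp: n mult.commute[of "int q"])
  qed
  then show ?thesis
    using \<open>q > 0\<close> by (auto simp: n)
qed

text \<open>Every order divides \<open>n\<close>, so a prime order is a prime factor of
  \<open>n\<close>.\<close>

lemma prime_ord_elems_eq:
  assumes "n > 0"
  shows "prime_ord_elems n =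
    (\<Union>q\<in>prime_factors n. {x \<in> {0..<int n}. x \<noteq> 0 \<and> int n dvd int q * x})"
proof -
  have dvd: "group.ord (integer_mod_group n) x dvd n" if "x \<in> {0..<int n}" for x
  proof -
    interpret group "integer_mod_group n" by simp
    have "x \<in> carrier (integer_mod_group n)"
      using assms that by (simp add: carrier_integer_mod_group)
    then show ?thesis
      using pow_eq_id[of x n] by simp
  qed
  have "x \<in> prime_ord_elems n \<longleftrightarrow> (\<exists>q\<in>prime_factors n. x \<noteq> 0 \<and> int n dvd int q * x)"
    if x: "x \<in> {0..<int n}" for x
  proof -
    have "x \<in> prime_ord_elems n \<longleftrightarrow> group.ord (integer_mod_group n) x \<in> prime_factors n"
      using x assms dvd[OF x] by (simp add: prime_ord_elems_def prime_factors_dvd)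
    also have "\<dots> \<longleftrightarrow> (\<exists>q\<in>prime_factors n. group.ord (integer_mod_group n) x = q)"
      by blast
    also have "\<dots> \<longleftrightarrow> (\<exists>q\<in>prime_factors n. x \<noteq> 0 \<and> int n dvd int q * x)"
      using ord_integer_mod_group_eq_prime_iff[OF assms x] in_prime_factors_imp_prime by blast
    finally show ?thesis .
  qed
  moreover have "prime_ord_elems n \<subseteq> {0..<int n}"
    by (auto simp: prime_ord_elems_def)
  ultimately show ?thesis
    by blast
qed

text \<open>The elements of order \<open>q\<close> are the subgroup of order \<open>q\<close>
  without 0. On that subgroup the character becomes one of the integers mod \<open>q\<close>, so
  orthogonality gives \<open>q\<close> or 0, and leaving out 0 costs 1.\<close>

lemma sum_zchar_prime_ord_elems:
  assumes "n > 0"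
  shows "(\<Sum>s\<in>prime_ord_elems n. zchar n a s) =
    (\<Sum>q\<in>prime_factors n. (if int q dvd a then of_nat q else 0) - 1)"
proof -
  let ?M = "\<lambda>q. {x \<in> {0..<int n}. x \<noteq> 0 \<and> int n dvd int q * x}"
  have "(\<Sum>s\<in>prime_ord_elems n. zchar n a s) = (\<Sum>q\<in>prime_factors n. \<Sum>s\<in>?M q. zchar n a s)"
    unfolding prime_ord_elems_eq[OF assms]
  proof (rule sum.UNION_disjoint)
    \<comment> \<open>An element of two of these sets would have two different orders.\<close>
    show "\<forall>q\<in>prime_factors n. \<forall>q'\<in>prime_factors n. q \<noteq> q' \<longrightarrow> ?M q \<inter> ?M q' = {}"
      using ord_integer_mod_group_eq_prime_iff[OF assms] in_prime_factors_imp_prime by blast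
    show "\<forall>q\<in>prime_factors n. finite (?M q)"
      by (auto intro: finite_subset[of _ "{0..<int n}"])
  qed simp
  also have "\<dots> = (\<Sum>q\<in>prime_factors n. (if int q dvd a then of_nat q else 0) - 1)"
  proof (rule sum.cong[OF refl])
    fix q assume "q \<in> prime_factors n"
    then have q: "q dvd n" "q > 0"
      by (simp_all add: in_prime_factors_imp_dvd in_prime_factors_imp_prime prime_gt_0_nat)
    obtain m where n: "n = q * m"
      using q(1) ..
    then have m: "m > 0"
      using assms by simp
    let ?N = "{x \<in> {0..<int n}. int n dvd int q * x}"
    have "finite ?N"
      by (rule finite_subset[of _ "{0..<int n}"]) auto
    moreover have "0 \<in> ?N"
      using assms by simp
    ultimately have "(\<Sum>s\<in>?N. zchar n a s) = zchar n a 0 + (\<Sum>s\<in>?N - {0}. zchar n a s)"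
      by (rule sum.remove)
    moreover have "?M q = ?N - {0}"
      by blast
    ultimately have "(\<Sum>s\<in>?M q. zchar n a s) = (\<Sum>s\<in>?N. zchar n a s) - 1"
      by (simp only: zchar_0 add_diff_cancel_left')
    also have "(\<Sum>s\<in>?N. zchar n a s) = (\<Sum>j\<in>{0..<int q}. zchar n a (int m * j))"
    proof -
      have "inj_on (\<lambda>j. int m * j) {0..<int q}"
        using m by (simp add: inj_on_def)
      moreover have "?N = (\<lambda>j. int m * j) ` {0..<int q}"
        using multiples_eq_image[OF assms q(1)] q(2) n by simp
      ultimately show ?thesis
        by (simp only: sum.reindex o_def)
    qed
    also have "\<dots> = (\<Sum>j\<in>{0..<int q}. zchar q a j)"
    proof -
      \<comment> \<open>The factor \<open>m\<close> cancels against \<open>n = q * m\<close>, so the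
        restricted character keeps the index \<open>a\<close>.\<close>
      have "of_int (a * (int m * j)) / of_nat n = (of_int (a * j) / of_nat q :: real)" for j
        using m q(2) by (simp add: n field_simps)
      then show ?thesis
        by (simp only: zchar_def)
    qed
    finally show "(\<Sum>s\<in>?M q. zchar n a s) = (if int q dvd a then of_nat q else 0) - 1"
      using q by (simp add: sum_zchar)
  qed
  finally show ?thesis .
qed

text \<open>Substituting \<open>s = (x + y) mod n\<close> splits off the factor
  \<open>zchar n a y\<close>, which moves to the other side as \<open>zchar n a (- y)\<close>. This
  is where the character gets reflected.\<close>

lemma sum_zchar_reflect:
  assumes "n > 0"
  shows "(\<Sum>x | x \<in> {0..<int n} \<and> (x + y) mod int n \<in> S. zchar n a x) =
    (\<Sum>s\<in>S \<inter> {0..<int n}. zchar n a s) * zchar n a (- y)"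
proof -
  have "bij_betw (\<lambda>x. (x + y) mod int n) {x \<in> {0..<int n}. (x + y) mod int n \<in> S} (S \<inter> {0..<int n})"
  proof -
    have b: "bij_betw (\<lambda>x. (x + y) mod int n) {0..<int n} {0..<int n}"
      using assms by (intro bij_betw_add_mod) simp
    have "(\<lambda>x. (x + y) mod int n) ` {x \<in> {0..<int n}. (x + y) mod int n \<in> S} = S \<inter> {0..<int n}"
      using b unfolding bij_betw_def by fastforce
    then show ?thesis
      by (intro bij_betw_subset[OF b]) auto
  qed
  then have "(\<Sum>s\<in>S \<inter> {0..<int n}. zchar n a s) =
    (\<Sum>x | x \<in> {0..<int n} \<and> (x + y) mod int n \<in> S. zchar n a ((x + y) mod int n))"
    by (rule sum.reindex_bij_betw[symmetric])
  also have "\<dots> = (\<Sum>x | x \<in> {0..<int n} \<and> (x + y) mod int n \<in> S. zchar n a x) * zchar n a y"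
    using assms by (simp only: zchar_mod zchar_add sum_distrib_right)
  finally show ?thesis
    using zchar_add[of n a y "- y"] by (simp add: mult.assoc)
qed

section \<open>Sets of primes dividing a nonzero residue\<close>

text \<open>Among the \<open>p i\<close>, the product over \<open>T\<close> is divisible by exactly
  those with \<open>i \<in> T\<close>. Being squarefree, it is a multiple of the modulus only if
  \<open>T = I\<close> and all exponents are 1. In that case every \<open>a\<close> divisible by all
  \<open>p i\<close> is a multiple of the modulus.\<close>

lemma ex_int_dvd_iff_mem:
  fixes p r :: "nat \<Rightarrow> nat" and I :: "nat set"
  assumes "finite I" and p: "\<And>i. i \<in> I \<Longrightarrow> Factorial_Ring.prime (p i)" and inj: "inj_on p I"
    and r: "\<And>i. i \<in> I \<Longrightarrow> r i \<ge> 1" and T: "T \<subseteq> I"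
  shows "(\<exists>a. \<not> int (\<Prod>i\<in>I. p i ^ r i) dvd a \<and> {i \<in> I. int (p i) dvd a} = T) \<longleftrightarrow>
    T \<noteq> I \<or> (\<exists>i\<in>I. r i \<ge> 2)"
proof
  assume "\<exists>a. \<not> int (\<Prod>i\<in>I. p i ^ r i) dvd a \<and> {i \<in> I. int (p i) dvd a} = T"
  then obtain a where a: "\<not> int (\<Prod>i\<in>I. p i ^ r i) dvd a" "{i \<in> I. int (p i) dvd a} = T"
    by blast
  show "T \<noteq> I \<or> (\<exists>i\<in>I. r i \<ge> 2)"
  proof (rule ccontr)
    assume "\<not> (T \<noteq> I \<or> (\<exists>i\<in>I. r i \<ge> 2))"
    then have "T = I" and r2: "\<forall>i\<in>I. \<not> r i \<ge> 2"
      by auto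
    have r1: "r i = 1" if "i \<in> I" for i
      using r[OF that] r2 that by force
    \<comment> \<open>Distinct primes are coprime, so their product divides \<open>a\<close>; the
      induction adds one prime at a time.\<close>
    have "(\<Prod>i\<in>J. p i) dvd nat \<bar>a\<bar>" if "J \<subseteq> I" for J
      using finite_subset[OF that \<open>finite I\<close>] that
    proof (induction J rule: finite_induct)
      case (insert j J)
      have "coprime (p j) (\<Prod>i\<in>J. p i)"
        using insert.prems insert.hyps inj p
        by (intro prod_coprime_right primes_coprime) (auto simp: inj_on_def)
      moreover have "p j dvd nat \<bar>a\<bar>"
        using a(2) \<open>T = I\<close> insert.prems
        by (auto simp: nat_abs_dvd_iff int_dvd_int_iff[symmetric])
      moreover have "(\<Prod>i\<in>J. p i) dvd nat \<bar>a\<bar>"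
        using insert by simp
      ultimately show ?case
        using insert.hyps by (metis prod.insert divides_mult)
    qed simp
    then have "(\<Prod>i\<in>I. p i ^ r i) dvd nat \<bar>a\<bar>"
      using r1 by simp
    then show False
      using a(1) by (simp only: int_dvd_int_iff[symmetric]) simp
  qed
next
  assume R: "T \<noteq> I \<or> (\<exists>i\<in>I. r i \<ge> 2)"
  define b where "b = (\<Prod>i\<in>T. p i)"
  have finT: "finite T"
    using T \<open>finite I\<close> finite_subset by blast
  have dvd: "p i dvd b \<longleftrightarrow> i \<in> T" if "i \<in> I" for i
  proof -
    have "p i dvd b \<longleftrightarrow> (\<exists>j\<in>T. p i dvd p j)"
      unfolding b_def using finT p that by (intro prime_dvd_prod_iff)
    also have "\<dots> \<longleftrightarrow> (\<exists>j\<in>T. p i = p j)"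
      using p T that by (metis dvd_refl primes_dvd_imp_eq subsetD)
    also have "\<dots> \<longleftrightarrow> i \<in> T"
      using inj T that by (auto simp: inj_on_def)
    finally show ?thesis .
  qed
  have "\<not> (\<Prod>i\<in>I. p i ^ r i) dvd b"
  proof
    assume D: "(\<Prod>i\<in>I. p i ^ r i) dvd b"
    have pow: "p i ^ r i dvd b" if "i \<in> I" for i
      using D dvd_prodI[OF \<open>finite I\<close> that, of "\<lambda>i. p i ^ r i"] dvd_trans by blast
    have "i \<in> T" if "i \<in> I" for i
    proof -
      have "p i dvd p i ^ r i"
        using r[OF that] by (intro dvd_power) simp
      then show ?thesis
        using pow[OF that] dvd[OF that] dvd_trans by blast
    qed
    then have "T = I" using T by blast
    then obtain i where i: "i \<in> I" "r i \<ge> 2" using R by blast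
    \<comment> \<open>If the square of \<open>p i\<close> divided \<open>b\<close>, then
      \<open>p i\<close> would divide the product of the other primes.\<close>
    have "p i ^ 2 dvd b"
      using pow[OF i(1)] i(2) le_imp_power_dvd dvd_trans by blast
    also have "b = p i * (\<Prod>j\<in>I - {i}. p j)"
      unfolding b_def \<open>T = I\<close> using \<open>finite I\<close> i by (simp add: prod.remove)
    finally have "p i dvd (\<Prod>j\<in>I - {i}. p j)"
      using p[OF i(1)] by (simp add: power2_eq_square prime_gt_0_nat)
    then obtain j where "j \<in> I" "j \<noteq> i" "p i dvd p j"
      using p[OF i(1)] \<open>finite I\<close> by (auto simp: prime_dvd_prod_iff)
    then show False
      using p i(1) inj primes_dvd_imp_eq by (metis inj_on_def)
  qed
  then have "\<not> int (\<Prod>i\<in>I. p i ^ r i) dvd int b" "{i \<in> I. int (p i) dvd int b} = T"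
    using dvd T by (auto simp only: int_dvd_int_iff)
  then show "\<exists>a. \<not> int (\<Prod>i\<in>I. p i ^ r i) dvd a \<and> {i \<in> I. int (p i) dvd a} = T"
    by blast
qed

section \<open>The spectrum in terms of character sums\<close>

text \<open>\<open>c a\<close> is the character sum over the elements of prime order, and
  \<open>c 0\<close> is their number. For a multiple \<open>a\<close> of \<open>n\<close> the
  character and its reflection are both constant, so only the difference
  \<open>c 0 - c 0 = 0\<close> arises, listed separately.\<close>

lemma laplacian_eigenvalues_integer_mod_group:
  fixes vs :: "int list"
  assumes n: "n > 0" "odd n" and vs: "distinct vs" "set vs = carrier (integer_mod_group n)"
  defines "c \<equiv> \<lambda>a. (\<Sum>q\<in>prime_factors n. (if int q dvd a then of_nat q else 0) - 1) :: complex"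
  shows "laplacian_eigenvalues (prime_order_graph (integer_mod_group n)) vs =
    {0} \<union> (\<Union>a\<in>{a. \<not> int n dvd a}. {c 0 - c a, c 0 + c a})"
proof -
  let ?Z = "{0..<int n}"
  let ?S = "prime_ord_elems n"
  define A :: "(int \<Rightarrow> complex) \<Rightarrow> int \<Rightarrow> complex" where
    "A f x = (\<Sum>y | y \<in> ?Z \<and> (y + x) mod int n \<in> ?S. f y)" for f x
  interpret group "integer_mod_group n" by simp
  have c_minus: "c (- a) = c a" for a
    by (simp add: c_def)
  have A_zchar: "A (zchar n a) x = c a * zchar n a (- x)" for a x
  proof -
    have "?S \<inter> ?Z = ?S"
      by (auto simp: prime_ord_elems_def)
    then show ?thesis
      using sum_zchar_reflect[OF n(1), of a x ?S] sum_zchar_prime_ord_elems[OF n(1), of a]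
      by (simp only: A_def c_def)
  qed
  have A_zchar_uminus: "A (\<lambda>y. zchar n a (- y)) x = c a * zchar n a x" for a x
    using A_zchar[of "- a" x] by (simp add: zchar_uminus_left[abs_def] c_minus)
  \<comment> \<open>Constants are multiples of the character of index 0; this makes the degree term
    \<open>c 0\<close>.\<close>
  have A_const: "A (\<lambda>_. z) x = c 0 * z" for x z
    using A_zchar[of 0 x] by (simp add: A_def)
  have carrier: "carrier (integer_mod_group n) = ?Z"
    using n by (simp add: carrier_integer_mod_group)
  have "(\<Sum>y | y \<in> ?Z \<and> Factorial_Ring.prime (ord ((x + y) mod int n)). f x - f y) =
      c 0 * f x - A f x" for f x
  proof -
    have "{y. y \<in> ?Z \<and> Factorial_Ring.prime (ord ((x + y) mod int n))} =
        {y. y \<in> ?Z \<and> (y + x) mod int n \<in> ?S}"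
      using n by (auto simp: prime_ord_elems_def add.commute)
    then show ?thesis
      using A_const[of "f x" x] by (simp only: sum_subtractf A_def)
  qed
  then have ev_iff: "ev \<in> laplacian_eigenvalues (prime_order_graph (integer_mod_group n)) vs \<longleftrightarrow>
      (\<exists>f. (\<exists>x\<in>?Z. f x \<noteq> 0) \<and> (\<forall>x\<in>?Z. c 0 * f x - A f x = ev * f x))" for ev
    unfolding mem_laplacian_eigenvalues_prime_order_graph_iff[OF vs] carrier mult_integer_mod_group
    by simp
  have sub: "ev \<in> {0} \<union> (\<Union>a\<in>{a. \<not> int n dvd a}. {c 0 - c a, c 0 + c a})"
    if f: "\<exists>x\<in>?Z. f x \<noteq> 0" and eq: "\<forall>x\<in>?Z. c 0 * f x - A f x = ev * f x" for ev f
  proof -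
    define F where "F a = (\<Sum>y\<in>?Z. zchar n a y * f y)" for a
    define \<mu> where "\<mu> = c 0 - ev"
    have A_eq: "A f x = \<mu> * f x" if "x \<in> ?Z" for x
      using eq that by (simp add: \<mu>_def algebra_simps)
    \<comment> \<open>Fourier transform of the eigenvalue equation. The kernel of \<open>A\<close>
      depends on \<open>y + x\<close> and so is symmetric; \<open>A\<close> moves from
      \<open>f\<close> onto the character and reflects its index.\<close>
    have F: "\<mu> * F a = c a * F (- a)" for a
    proof -
      have "\<mu> * F a = (\<Sum>x\<in>?Z. zchar n a x * A f x)"
        unfolding F_def sum_distrib_left by (intro sum.cong) (auto simp: A_eq)
      also have "\<dots> = (\<Sum>x\<in>?Z. \<Sum>y\<in>?Z. if (y + x) mod int n \<in> ?S then zchar n a x * f y else 0)"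
        by (simp add: A_def sum_distrib_left sum.inter_filter[symmetric])
      also have "\<dots> = (\<Sum>y\<in>?Z. \<Sum>x\<in>?Z. if (y + x) mod int n \<in> ?S then zchar n a x * f y else 0)"
        by (rule sum.swap)
      also have "\<dots> = (\<Sum>y\<in>?Z. A (zchar n a) y * f y)"
        by (simp add: A_def sum_distrib_right sum.inter_filter[symmetric] add.commute)
      also have "\<dots> = c a * F (- a)"
        by (simp add: A_zchar F_def sum_distrib_left zchar_uminus_left mult.assoc)
      finally show ?thesis .
    qed
    \<comment> \<open>By inversion, a nonzero \<open>f\<close> has a nonzero Fourier
      coefficient.\<close>
    obtain a where a: "a \<in> ?Z" "F a \<noteq> 0"
    proof -
      obtain x where x: "x \<in> ?Z" "f x \<noteq> 0"
        using f by blast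
      have "(\<Sum>a\<in>?Z. zchar n a (- x) * F a) = of_nat n * f x"
        using zchar_inversion[OF n(1) x(1)] by (simp only: F_def)
      then have "(\<Sum>a\<in>?Z. zchar n a (- x) * F a) \<noteq> 0"
        using n x by simp
      then obtain a where "a \<in> ?Z" "zchar n a (- x) * F a \<noteq> 0"
        by (rule sum.not_neutral_contains_not_neutral)
      then show thesis
        using that by simp
    qed
    show ?thesis
    proof (cases "a = 0")
      case True
      \<comment> \<open>Index 0 is its own negative, so no choice of sign arises.\<close>
      then have "\<mu> = c 0"
        using F[of 0] a by simp
      then show ?thesis
        by (simp add: \<mu>_def)
    next
      case False
      \<comment> \<open>The relation \<open>F\<close> used at \<open>a\<close> and then at
        \<open>- a\<close> leads back to \<open>F a\<close>.\<close>
      have "\<mu> * (\<mu> * F a) = c a * (c a * F a)"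
        using F[of a] F[of "- a"] by (simp add: c_minus mult.left_commute)
      then have "\<mu> = c a \<or> \<mu> = - c a"
        using a(2) by (simp add: mult.assoc[symmetric] square_eq_iff)
      then have "ev = c 0 - c a \<or> ev = c 0 + c a"
        unfolding \<mu>_def by (auto simp: algebra_simps)
      moreover have "\<not> int n dvd a"
        using False a(1) by (auto dest: zdvd_imp_le)
      ultimately show ?thesis
        by blast
    qed
  qed
  have zero: "\<exists>f. (\<exists>x\<in>?Z. f x \<noteq> 0) \<and> (\<forall>x\<in>?Z. c 0 * f x - A f x = 0 * f x)"
    using n by (intro exI[of _ "\<lambda>_. 1"]) (auto simp: A_const intro!: bexI[of _ 0])
  have minus: "\<exists>f. (\<exists>x\<in>?Z. f x \<noteq> 0) \<and> (\<forall>x\<in>?Z. c 0 * f x - A f x = (c 0 - c a) * f x)" for a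
  proof (intro exI[of _ "\<lambda>x. zchar n a x + zchar n a (- x)"] conjI ballI)
    \<comment> \<open>At 0 the even combination has the value 2, whatever \<open>a\<close>
      is.\<close>
    show "\<exists>x\<in>?Z. zchar n a x + zchar n a (- x) \<noteq> 0"
      using n by (intro bexI[of _ 0]) auto
    fix x
    have "A (\<lambda>x. zchar n a x + zchar n a (- x)) x = c a * (zchar n a x + zchar n a (- x))"
      using A_zchar[of a x] A_zchar_uminus[of a x] by (simp add: A_def sum.distrib ring_distribs)
    then show "c 0 * (zchar n a x + zchar n a (- x)) - A (\<lambda>x. zchar n a x + zchar n a (- x)) x =
        (c 0 - c a) * (zchar n a x + zchar n a (- x))"
      by (simp only: left_diff_distrib)
  qed
  have plus: "\<exists>f. (\<exists>x\<in>?Z. f x \<noteq> 0) \<and> (\<forall>x\<in>?Z. c 0 * f x - A f x = (c 0 + c a) * f x)"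
    if a: "\<not> int n dvd a" for a
  proof (intro exI[of _ "\<lambda>x. zchar n a x - zchar n a (- x)"] conjI ballI)
    \<comment> \<open>The odd combination vanishes at 0 and is tested at 1, which lies in
      \<open>?Z\<close> as \<open>n \<noteq> 1\<close>. If it vanished there too, \<open>n\<close>
      would divide \<open>a * 2\<close> and hence, being odd, \<open>a\<close>.\<close>
    have "n \<noteq> 1"
      using a by auto
    moreover have "coprime (int n) 2"
      using n(2) by simp
    then have "\<not> int n dvd a * 2"
      using a by (simp add: coprime_dvd_mult_left_iff)
    then have "zchar n a (1 + 1) \<noteq> 1"
      using n(1) by (simp add: zchar_eq_1_iff)
    then have "zchar n a 1 \<noteq> zchar n a (- 1)"
      using zchar_add[of n a 1 1] zchar_add[of n a 1 "- 1"] by auto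
    ultimately show "\<exists>x\<in>?Z. zchar n a x - zchar n a (- x) \<noteq> 0"
      using n(1) by (intro bexI[of _ 1]) auto
    fix x
    have "A (\<lambda>x. zchar n a x - zchar n a (- x)) x = - (c a * (zchar n a x - zchar n a (- x)))"
      using A_zchar[of a x] A_zchar_uminus[of a x]
      by (simp add: A_def sum_subtractf right_diff_distrib)
    then show "c 0 * (zchar n a x - zchar n a (- x)) - A (\<lambda>x. zchar n a x - zchar n a (- x)) x =
        (c 0 + c a) * (zchar n a x - zchar n a (- x))"
      by (simp only: distrib_right diff_minus_eq_add)
  qed
  show ?thesis
  proof (intro equalityI subsetI)
    fix ev
    assume "ev \<in> laplacian_eigenvalues (prime_order_graph (integer_mod_group n)) vs"
    then obtain f where "\<exists>x\<in>?Z. f x \<noteq> 0" "\<forall>x\<in>?Z. c 0 * f x - A f x = ev * f x"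
      unfolding ev_iff by blast
    then show "ev \<in> {0} \<union> (\<Union>a\<in>{a. \<not> int n dvd a}. {c 0 - c a, c 0 + c a})"
      by (rule sub)
  next
    fix ev
    assume "ev \<in> {0} \<union> (\<Union>a\<in>{a. \<not> int n dvd a}. {c 0 - c a, c 0 + c a})"
    then consider "ev = 0" | a where "ev = c 0 - c a" | a where "\<not> int n dvd a" "ev = c 0 + c a"
      by blast
    then show "ev \<in> laplacian_eigenvalues (prime_order_graph (integer_mod_group n)) vs"
      unfolding ev_iff by cases (simp_all only: zero minus plus simp_thms)
  qed
qed

section \<open>From character sums to sums over subsets of the index set\<close>

text \<open>The two cases differ because \<open>T = {1..k}\<close>, the source of
  \<open>2 * (P {1..k} - of_nat k)\<close>, comes from a nonzero residue only if some exponent is at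
  least 2.\<close>

theorem theorem3p3:
  fixes n k :: nat and p r :: "nat \<Rightarrow> nat" and vs :: "int list"
  defines "P \<equiv> (\<lambda>T. \<Sum>i\<in>T. of_nat (p i) :: complex)"
  assumes "odd n"
    and "n = (\<Prod>i\<in>{1..k}. p i ^ r i)"
    and "strict_mono_on {1..k} p"
    and "\<And>i. i \<in> {1..k} \<Longrightarrow> Factorial_Ring.prime (p i)"
    and "\<And>i. i \<in> {1..k} \<Longrightarrow> r i \<ge> 1"
    and "distinct vs" and "set vs = carrier (integer_mod_group n)"
  shows "((\<exists>i\<in>{1..k}. r i \<ge> 2) \<longrightarrow>
           laplacian_eigenvalues (prime_order_graph (integer_mod_group n)) vs =
             {0, 2 * (P {1..k} - of_nat k), P {1..k} - 2 * of_nat k, P {1..k}}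
             \<union> {P {1..k} - P A | l A. l \<in> {1..k - 1} \<and> A \<subseteq> {1..k} \<and> card A = l}
             \<union> {P {1..k} + P A - 2 * of_nat k | l A. l \<in> {1..k - 1} \<and> A \<subseteq> {1..k} \<and> card A = l})
       \<and> ((\<forall>i\<in>{1..k}. r i = 1) \<longrightarrow>
           laplacian_eigenvalues (prime_order_graph (integer_mod_group n)) vs =
             {0, P {1..k} - 2 * of_nat k, P {1..k}}
             \<union> {P {1..k} - P A | l A. l \<in> {1..k - 1} \<and> A \<subseteq> {1..k} \<and> card A = l}
             \<union> {P {1..k} + P A - 2 * of_nat k | l A. l \<in> {1..k - 1} \<and> A \<subseteq> {1..k} \<and> card A = l})"
proof -
  let ?I = "{1..k}"
  let ?L = "laplacian_eigenvalues (prime_order_graph (integer_mod_group n)) vs"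
  let ?F = "\<lambda>T. {P ?I - P T, P ?I + P T - 2 * of_nat k}"
  have inj: "inj_on p ?I"
    using assms(4) by (rule strict_mono_on_imp_inj_on)
  have "n > 0"
    using assms(2) by (rule odd_pos)
  have "prime_factors n = p ` ?I"
  proof -
    have "q \<in> prime_factors n \<longleftrightarrow> q \<in> p ` ?I" for q
    proof -
      have "q \<in> prime_factors n \<longleftrightarrow> Factorial_Ring.prime q \<and> (\<exists>i\<in>?I. q dvd p i ^ r i)"
      proof -
        have "q dvd n \<longleftrightarrow> (\<exists>i\<in>?I. q dvd p i ^ r i)" if "Factorial_Ring.prime q"
          unfolding assms(3) using that by (intro prime_dvd_prod_iff) simp
        then show ?thesis
          using \<open>n > 0\<close> by (auto simp: prime_factors_dvd)
      qed
      also have "\<dots> \<longleftrightarrow> Factorial_Ring.prime q \<and> (\<exists>i\<in>?I. q = p i)"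
        using assms(5,6) by (metis dvd_power not_one_le_zero prime_dvd_power primes_dvd_imp_eq zero_less_iff_neq_zero)
      also have "\<dots> \<longleftrightarrow> q \<in> p ` ?I"
        using assms(5) by blast
      finally show ?thesis .
    qed
    then show ?thesis
      by blast
  qed
  \<comment> \<open>By injectivity of \<open>p\<close> the sum runs over the indices, and the
    \<open>k\<close> terms \<open>- 1\<close> add up to \<open>- of_nat k\<close>.\<close>
  then have c: "(\<Sum>q\<in>prime_factors n. (if int q dvd a then of_nat q else 0) - 1) =
      P {i \<in> ?I. int (p i) dvd a} - of_nat k" for a
  proof -
    have "(\<Sum>q\<in>prime_factors n. (if int q dvd a then of_nat q else 0) - 1) =
        (\<Sum>i\<in>?I. if int (p i) dvd a then of_nat (p i) else 0) - (of_nat k :: complex)"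
      unfolding \<open>prime_factors n = p ` ?I\<close> sum.reindex[OF inj] by (simp add: sum_subtractf)
    then show ?thesis
      unfolding P_def by (simp only: sum.inter_filter finite_atLeastAtMost)
  qed
  have "?L = {0} \<union> (\<Union>a\<in>{a. \<not> int n dvd a}. ?F {i \<in> ?I. int (p i) dvd a})"
  proof -
    have "{i \<in> ?I. int (p i) dvd 0} = ?I"
      by auto
    \<comment> \<open>The shifts by \<open>k\<close> cancel in the difference and double in the
      sum.\<close>
    moreover have "{P ?I - of_nat k - (z - of_nat k), P ?I - of_nat k + (z - of_nat k)} =
        {P ?I - z, P ?I + z - 2 * of_nat k}" for z
      by (simp add: algebra_simps)
    ultimately show ?thesis
      unfolding laplacian_eigenvalues_integer_mod_group[OF \<open>n > 0\<close> assms(2,7,8)] c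
      by (simp only:)
  qed
  also have "\<dots> = {0} \<union> (\<Union>T\<in>(\<lambda>a. {i \<in> ?I. int (p i) dvd a}) ` {a. \<not> int n dvd a}. ?F T)"
    by simp
  also have "(\<lambda>a. {i \<in> ?I. int (p i) dvd a}) ` {a. \<not> int n dvd a} =
      {T. T \<subseteq> ?I \<and> (T \<noteq> ?I \<or> (\<exists>i\<in>?I. r i \<ge> 2))}"
  proof (rule Set.set_eqI)
    fix T
    have "T \<in> (\<lambda>a. {i \<in> ?I. int (p i) dvd a}) ` {a. \<not> int n dvd a} \<longleftrightarrow>
        T \<subseteq> ?I \<and> (\<exists>a. \<not> int n dvd a \<and> {i \<in> ?I. int (p i) dvd a} = T)"
      by auto
    also have "\<dots> \<longleftrightarrow> T \<subseteq> ?I \<and> (T \<noteq> ?I \<or> (\<exists>i\<in>?I. r i \<ge> 2))"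
      using ex_int_dvd_iff_mem[of ?I p r T] assms(5,6) inj
      unfolding assms(3) by (intro conj_cong refl) simp_all
    finally show "T \<in> (\<lambda>a. {i \<in> ?I. int (p i) dvd a}) ` {a. \<not> int n dvd a} \<longleftrightarrow>
        T \<in> {T. T \<subseteq> ?I \<and> (T \<noteq> ?I \<or> (\<exists>i\<in>?I. r i \<ge> 2))}"
      by simp
  qed
  finally have L: "?L = {0} \<union> (\<Union>T\<in>{T. T \<subseteq> ?I \<and> (T \<noteq> ?I \<or> (\<exists>i\<in>?I. r i \<ge> 2))}. ?F T)" .
  \<comment> \<open>The sizes from 1 to \<open>k - 1\<close> are those of the nonempty proper
    subsets.\<close>
  define W where "W = {T. T \<subset> ?I \<and> T \<noteq> {}}"
  have W: "{h A | l A. l \<in> {1..k - 1} \<and> A \<subseteq> ?I \<and> card A = l} = h ` W" for h :: "nat set \<Rightarrow> complex"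
  proof -
    have "card A \<in> {1..k - 1} \<longleftrightarrow> A \<noteq> ?I \<and> A \<noteq> {}" if "A \<subseteq> ?I" for A
    proof (cases "A = ?I")
      case False
      then have "card A < k"
        using psubset_card_mono[of ?I A] that by auto
      moreover have "card A = 0 \<longleftrightarrow> A = {}"
        using that finite_subset[of A ?I] by simp
      ultimately show ?thesis
        using False by auto
    qed auto
    then have "{A. A \<subseteq> ?I \<and> card A \<in> {1..k - 1}} = W"
      unfolding W_def by (intro Collect_cong) (metis psubset_eq)
    moreover have "{h A | l A. l \<in> {1..k - 1} \<and> A \<subseteq> ?I \<and> card A = l} =
        h ` {A. A \<subseteq> ?I \<and> card A \<in> {1..k - 1}}"
      by auto
    ultimately show ?thesis
      by simp
  qed
  have proper: "{0} \<union> (\<Union>T\<in>{T. T \<subset> ?I}. ?F T) =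
      {0, P ?I - 2 * of_nat k, P ?I} \<union> (\<lambda>A. P ?I - P A) ` W \<union> (\<lambda>A. P ?I + P A - 2 * of_nat k) ` W"
  proof (cases "k = 0")
    case True
    \<comment> \<open>For \<open>k = 0\<close> there is no proper subset, but all listed values
      equal 0 since \<open>P {} = 0\<close>.\<close>
    then show ?thesis
      by (auto simp: W_def P_def)
  next
    case False
    \<comment> \<open>\<open>T = {}\<close> accounts for the two values \<open>P ?I\<close> and
      \<open>P ?I - 2 * of_nat k\<close>.\<close>
    then have "{T. T \<subset> ?I} = insert {} W"
      by (auto simp: W_def)
    moreover have "P {} = 0"
      by (simp add: P_def)
    ultimately show ?thesis
      by auto
  qed
  show ?thesis
  proof (intro conjI impI)
    assume "\<exists>i\<in>?I. r i \<ge> 2"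
    then have "{T. T \<subseteq> ?I \<and> (T \<noteq> ?I \<or> (\<exists>i\<in>?I. r i \<ge> 2))} = insert ?I {T. T \<subset> ?I}"
      by auto
    then have "?L = ?F ?I \<union> ({0} \<union> (\<Union>T\<in>{T. T \<subset> ?I}. ?F T))"
      unfolding L by auto
    moreover have "?F ?I = {0, 2 * (P ?I - of_nat k)}"
      by (simp add: algebra_simps)
    ultimately show "?L = {0, 2 * (P ?I - of_nat k), P ?I - 2 * of_nat k, P ?I}
        \<union> {P ?I - P A | l A. l \<in> {1..k - 1} \<and> A \<subseteq> ?I \<and> card A = l}
        \<union> {P ?I + P A - 2 * of_nat k | l A. l \<in> {1..k - 1} \<and> A \<subseteq> ?I \<and> card A = l}"
      unfolding W proper by auto
  next
    assume "\<forall>i\<in>?I. r i = 1"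
    then have "{T. T \<subseteq> ?I \<and> (T \<noteq> ?I \<or> (\<exists>i\<in>?I. r i \<ge> 2))} = {T. T \<subset> ?I}"
      by auto
    then show "?L = {0, P ?I - 2 * of_nat k, P ?I}
        \<union> {P ?I - P A | l A. l \<in> {1..k - 1} \<and> A \<subseteq> ?I \<and> card A = l}
        \<union> {P ?I + P A - 2 * of_nat k | l A. l \<in> {1..k - 1} \<and> A \<subseteq> ?I \<and> card A = l}"
      unfolding L W by (simp only: proper)
  qed
qed

end
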